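(* Let $a>b>0$, $c^2=a^2-b^2$, let $\mathcal{E}$ be the ellipse $x^2/a^2+y^2/b^2=1$, and let $C=[x_c,y_c]$ be a point interior to $\mathcal{E}$. Let $\mathcal{T}_\circ$ be the Poncelet family of triangles inscribed in $\mathcal{E}$ and circumscribing a circle centered at $C$. Then the semi-axis lengths $a_4$ (major) and $b_4$ (minor) of the locus $\mathcal{L}_4$ of the orthocenter $X_4$ over $\mathcal{T}_\circ$ are given by \[ a_4^2=\frac{z_4}{a^2b^4c^4},\qquad b_4^2=\frac{z_4}{b^2a^4c^4}, \] where \[ z_4=(a^2+b^2)(a^8y_c^2+b^8x_c^2-4a^3b^3\delta)+a^8b^4+a^6b^4(6b^2-z_4')+a^4b^6(b^2-z_4'),\qquad z_4'=x_c^2+y_c^2, \] and $\delta=\sqrt{(b^4+c^2y_c^2)(a^4-c^2x_c^2)}$.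
   Context: For each point $C=[x_c,y_c]$ interior to $\mathcal{E}$ there is exactly one circle $\mathcal{K}$ centered at $C$, nested in $\mathcal{E}$, admitting triangles inscribed in $\mathcal{E}$ with all sides tangent to $\mathcal{K}$; its radius is $r=\big(b\sqrt{a^4-c^2x_c^2}-a\sqrt{b^4+c^2y_c^2}\big)/c^2$. By Poncelet's porism every point of $\mathcal{E}$ is then a vertex of exactly one such triangle. $\mathcal{T}_\circ$ is the family of all these triangles; $\mathcal{K}$ is their common incircle. The locus $\mathcal{L}_k$ of a triangle center $X_k$ is the set of positions of $X_k(T)$ as $T$ ranges over $\mathcal{T}_\circ$. It is known that $\mathcal{L}_4$ is an ellipse (possibly degenerating to a point) homothetic to a $90^\circ$-rotated copy of $\mathcal{E}$, with center $\left[\frac{a^2+b^2}{a^2}x_c,\frac{a^2+b^2}{b^2}y_c\right]$; thus its major axis is parallel to the $y$-axis. *)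

theory Defs
  imports "HOL-Analysis.Analysis"
begin

type_synonym point = "real \<times> real"

definition ellipse :: "real \<Rightarrow> real \<Rightarrow> point set" where
  "ellipse a b = {(x, y). x\<^sup>2 / a\<^sup>2 + y\<^sup>2 / b\<^sup>2 = 1}"

definition ellipse_interior :: "real \<Rightarrow> real \<Rightarrow> point set" where
  "ellipse_interior a b = {(x, y). x\<^sup>2 / a\<^sup>2 + y\<^sup>2 / b\<^sup>2 < 1}"

text \<open>For a circle of positive radius, a line is tangent iff it meets the circle in exactly
  one point. The line carrying a side of a triangle is used here.\<close>

definition tangent_line :: "point \<Rightarrow> point \<Rightarrow> point \<Rightarrow> real \<Rightarrow> bool" where
  "tangent_line P Q C r \<longleftrightarrow> (\<exists>T. affine hull {P, Q} \<inter> sphere C r = {T})"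

text \<open>Triangles are recorded with ordered vertices. The circle has a prescribed centre but its
  radius is not prescribed. As the circle lies inside the ellipse, a point where it
  touches the line through two vertices lies on the side itself, so the circle is the incircle
  and not an excircle.\<close>

definition poncelet_family :: "real \<Rightarrow> real \<Rightarrow> point \<Rightarrow> (point \<times> point \<times> point) set" where
  "poncelet_family a b C =
     {(P, Q, R). \<not> collinear {P, Q, R} \<and> {P, Q, R} \<subseteq> ellipse a b \<and>
        (\<exists>r>0. sphere C r \<subseteq> ellipse_interior a b \<and>
           tangent_line P Q C r \<and> tangent_line Q R C r \<and> tangent_line R P C r)}"

text \<open>The common point of the three altitudes.\<close>

definition orthocenter :: "point \<times> point \<times> point \<Rightarrow> point" where
  "orthocenter = (\<lambda>(P, Q, R). THE H.
     (H - P) \<bullet> (Q - R) = 0 \<and> (H - Q) \<bullet> (R - P) = 0 \<and> (H - R) \<bullet> (P - Q) = 0)"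

definition orthocenter_locus :: "real \<Rightarrow> real \<Rightarrow> point \<Rightarrow> point set" where
  "orthocenter_locus a b C = orthocenter ` poncelet_family a b C"

text \<open>\<open>S\<close> is an ellipse, in arbitrary position, with semi-axis lengths \<open>p\<close> (major) and
  \<open>q\<close> (minor). The parametric form also covers degeneration to a point (\<open>p = q = 0\<close>).\<close>

definition ellipse_with_semiaxes :: "point set \<Rightarrow> real \<Rightarrow> real \<Rightarrow> bool" where
  "ellipse_with_semiaxes S p q \<longleftrightarrow> 0 \<le> q \<and> q \<le> p \<and>
     (\<exists>M u v. norm u = 1 \<and> norm v = 1 \<and> u \<bullet> v = 0 \<and>
        S = {M + (p * cos t) *\<^sub>R u + (q * sin t) *\<^sub>R v | t. True})"

end

theory Submission
  imports Defs "HOL-Computational_Algebra.Fundamental_Theorem_Algebra"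
begin

text \<open>The affine map \<open>stretch a b\<close> carries the unit circle of the complex plane to the ellipse and
  an ellipse with foci \<open>f\<close>, \<open>g\<close> to the incircle. Tangency of a side is a
  polynomial equation in the sum and product of the two unit complex numbers at its ends. Hence the
  vertices \<open>z1\<close>, \<open>z2\<close>, \<open>z3\<close> of a triangle of the family are the roots of the Blaschke equation
  \<open>z (z - f) (z - g) = l (1 - f* z) (1 - g* z)\<close> (a star denoting conjugation) with \<open>l = z1 z2 z3\<close>.
  Conversely, every unit \<open>l\<close> gives three distinct unit roots. The
  orthocenter is the image under \<open>stretch (1 / (2 a)) (1 / (2 b))\<close> of
  \<open>(a\<^sup>2 + b\<^sup>2) (z1 + z2 + z3) - (a\<^sup>2 - b\<^sup>2) l\<close>. Since \<open>z1 + z2 + z3 = f + g + l (f g)*\<close>, this number is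
  affine in \<open>l\<close> and runs over a circle, so the orthocenter runs over an ellipse with axes in
  ratio \<open>a : b\<close>.\<close>

section \<open>Tangency of a chord as an equation in the sum and product of its ends\<close>

text \<open>Along the line, the sphere condition is a quadratic in the affine parameter with leading
  coefficient \<open>A > 0\<close>, so a single root means a vanishing discriminant.\<close>

lemma tangent_line_iff_discriminant:
  assumes "P \<noteq> Q" "r > 0"
  shows "tangent_line P Q C r \<longleftrightarrow>
    ((P - C) \<bullet> (Q - P))\<^sup>2 = (Q - P) \<bullet> (Q - P) * ((P - C) \<bullet> (P - C) - r\<^sup>2)"
proof -
  define A B D where "A = (Q - P) \<bullet> (Q - P)" and "B = (P - C) \<bullet> (Q - P)"
    and "D = (P - C) \<bullet> (P - C) - r\<^sup>2"
  have A: "A > 0" using assms by (simp add: A_def)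
  define g where "g t = P + t *\<^sub>R (Q - P)" for t
  have inj: "g s = g t \<longleftrightarrow> s = t" for s t
    using assms by (auto simp: g_def)
  have hull: "affine hull {P, Q} = range g"
    by (auto simp: affine_hull_2_alt g_def)
  have sph: "g t \<in> sphere C r \<longleftrightarrow> A * t\<^sup>2 + 2 * B * t + D = 0" for t
  proof -
    have "g t \<in> sphere C r \<longleftrightarrow> (norm (g t - C))\<^sup>2 = r\<^sup>2"
      using assms(2) by (auto simp: dist_norm norm_minus_commute)
    also have "(norm (g t - C))\<^sup>2 = A * t\<^sup>2 + 2 * B * t + D + r\<^sup>2"
      unfolding power2_norm_eq_inner g_def A_def B_def D_def
      by (simp add: inner_diff inner_add inner_commute algebra_simps power2_eq_square)
    finally show ?thesis by auto
  qed
  have sq: "A * (A * t\<^sup>2 + 2 * B * t + D) = (A * t + B)\<^sup>2 - (B\<^sup>2 - A * D)" for t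
    by (simp add: algebra_simps power2_eq_square)
  have root: "A * t\<^sup>2 + 2 * B * t + D = 0 \<longleftrightarrow> (A * t + B)\<^sup>2 = B\<^sup>2 - A * D" for t
    using sq[of t] A by (metis diff_0_right eq_iff_diff_eq_0 less_irrefl mult_eq_0_iff)
  have "tangent_line P Q C r \<longleftrightarrow> (\<exists>t. \<forall>s. (A * s + B)\<^sup>2 = B\<^sup>2 - A * D \<longleftrightarrow> s = t)"
  proof
    assume "tangent_line P Q C r"
    then obtain T where T: "range g \<inter> sphere C r = {T}"
      by (auto simp: tangent_line_def hull)
    then obtain t where "T = g t" by blast
    with T have "g s \<in> sphere C r \<longleftrightarrow> s = t" for s
      using inj by blast
    then have "(A * s + B)\<^sup>2 = B\<^sup>2 - A * D \<longleftrightarrow> s = t" for s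
      unfolding sph root .
    then show "\<exists>t. \<forall>s. (A * s + B)\<^sup>2 = B\<^sup>2 - A * D \<longleftrightarrow> s = t"
      by blast
  next
    assume "\<exists>t. \<forall>s. (A * s + B)\<^sup>2 = B\<^sup>2 - A * D \<longleftrightarrow> s = t"
    then obtain t where "\<And>s. g s \<in> sphere C r \<longleftrightarrow> s = t"
      unfolding sph root by blast
    then have "range g \<inter> sphere C r = {g t}" by (auto simp del: mem_sphere)
    then show "tangent_line P Q C r"
      by (auto simp: tangent_line_def hull)
  qed
  also have "\<dots> \<longleftrightarrow> B\<^sup>2 = A * D"
  proof
    assume "\<exists>t. \<forall>s. (A * s + B)\<^sup>2 = B\<^sup>2 - A * D \<longleftrightarrow> s = t"
    then obtain t where t: "\<And>s. (A * s + B)\<^sup>2 = B\<^sup>2 - A * D \<longleftrightarrow> s = t" by blast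
    \<comment> \<open>\<open>- 2 * B / A - t\<close> is the other root of the quadratic; uniqueness
      makes the two coincide.\<close>
    have "(A * (- 2 * B / A - t) + B)\<^sup>2 = (A * t + B)\<^sup>2"
      using A by (simp add: field_simps power2_eq_square)
    then have "- 2 * B / A - t = t" using t by metis
    then have "A * t + B = 0" using A by (simp add: field_simps)
    then show "B\<^sup>2 = A * D" using t[of t] by auto
  next
    assume "B\<^sup>2 = A * D"
    then have "(A * s + B)\<^sup>2 = B\<^sup>2 - A * D \<longleftrightarrow> s = - B / A" for s
      using A by (simp add: field_simps) (smt (verit) mult.commute)
    then show "\<exists>t. \<forall>s. (A * s + B)\<^sup>2 = B\<^sup>2 - A * D \<longleftrightarrow> s = t" by blast
  qed
  finally show ?thesis by (simp add: A_def B_def D_def)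
qed

definition stretch :: "real \<Rightarrow> real \<Rightarrow> complex \<Rightarrow> point" where
  "stretch a b z = (a * Re z, b * Im z)"

text \<open>With \<open>s = z1 + z2\<close> and \<open>p = z1 z2\<close>, \<open>m + p m* - s\<close> vanishes iff \<open>m\<close> lies on the chord
  through the unit numbers \<open>z1\<close>, \<open>z2\<close>. For \<open>n = m\<^sup>2 + \<kappa>\<close> and
  \<open>q = m m* - e\<close> the form below is its square plus \<open>\<kappa> (1 + p\<^sup>2) - 2 e p\<close>; with
  \<open>\<kappa> = r\<^sup>2 / b\<^sup>2 - r\<^sup>2 / a\<^sup>2\<close> and \<open>e = r\<^sup>2 / b\<^sup>2 + r\<^sup>2 / a\<^sup>2\<close> it vanishes iff the stretched chord has
  distance \<open>r\<close> from the image of \<open>m\<close>. Conjugates are separate arguments \<open>m'\<close>, \<open>n'\<close>, which makes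
  the elimination below plain field algebra.\<close>
definition chord_form :: "complex \<Rightarrow> complex \<Rightarrow> complex \<Rightarrow> complex \<Rightarrow> complex \<Rightarrow> complex \<Rightarrow> complex \<Rightarrow> complex"
  where "chord_form m m' n n' q s p =
    s\<^sup>2 - 2 * m * s - 2 * m' * s * p + 2 * q * p + n + n' * p\<^sup>2"

lemma mult_cnj_eq_1: "norm z = 1 \<Longrightarrow> z * cnj z = 1"
  using complex_norm_square[of z] by simp

lemma chord_form_eq:
  fixes z1 z2 m :: complex and \<kappa> e :: real
  assumes "norm z1 = 1" "norm z2 = 1"
  defines "d \<equiv> z2 - z1"
  defines "X \<equiv> (Re z1 - Re m) * Im d - (Im z1 - Im m) * Re d"
  shows "d\<^sup>2 * chord_form m (cnj m) (m\<^sup>2 + of_real \<kappa>) (cnj m ^ 2 + of_real \<kappa>) (m * cnj m - of_real e) (z1 + z2) (z1 * z2)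
    = - 4 * (z1 * z2)\<^sup>2 * of_real (X\<^sup>2 - (e + \<kappa>) / 2 * (Re d)\<^sup>2 - (e - \<kappa>) / 2 * (Im d)\<^sup>2)"
proof -
  define p where "p = z1 * z2"
  have u1: "z1 * cnj z1 = 1" and u2: "z2 * cnj z2 = 1"
    using assms by (simp_all add: mult_cnj_eq_1)
  have A0: "2 * \<i> * of_real X = cnj (z1 - m) * d - (z1 - m) * cnj d"
    by (simp add: X_def complex_eq_iff algebra_simps)
  have cd: "p * cnj d = - d"
    unfolding p_def d_def using u1 u2 by simp algebra
  have A: "2 * \<i> * of_real X * p = - d * (m + p * cnj m - (z1 + z2))"
  proof -
    have "2 * \<i> * of_real X * p = cnj (z1 - m) * d * p + (z1 - m) * d"
      unfolding A0 using cd by algebra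
    also have "\<dots> = - d * (m + p * cnj m - (z1 + z2))"
      unfolding p_def d_def using u1 by simp algebra
    finally show ?thesis .
  qed
  have X2: "d\<^sup>2 * (m + p * cnj m - (z1 + z2))\<^sup>2 = - 4 * p\<^sup>2 * (of_real X)\<^sup>2"
  proof -
    have "d\<^sup>2 * (m + p * cnj m - (z1 + z2))\<^sup>2 = (- d * (m + p * cnj m - (z1 + z2)))\<^sup>2"
      by (simp only: power_mult_distrib power2_minus)
    also have "\<dots> = (2 * \<i> * of_real X * p)\<^sup>2" unfolding A ..
    also have "\<dots> = - 4 * p\<^sup>2 * (of_real X)\<^sup>2" by (simp add: power_mult_distrib)
    finally show ?thesis .
  qed
  have Q: "of_real ((e + \<kappa>) / 2 * (Re d)\<^sup>2 + (e - \<kappa>) / 2 * (Im d)\<^sup>2) * 4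
      = 2 * of_real e * (d * cnj d) + of_real \<kappa> * (d\<^sup>2 + (cnj d)\<^sup>2)"
    by (simp add: complex_eq_iff power2_eq_square field_simps)
  have "p\<^sup>2 * (of_real ((e + \<kappa>) / 2 * (Re d)\<^sup>2 + (e - \<kappa>) / 2 * (Im d)\<^sup>2) * 4)
    = d\<^sup>2 * (of_real \<kappa> * (1 + p\<^sup>2) - 2 * of_real e * p)"
    unfolding Q using cd by algebra
  moreover have "chord_form m (cnj m) (m\<^sup>2 + of_real \<kappa>) (cnj m ^ 2 + of_real \<kappa>) (m * cnj m - of_real e) (z1 + z2) p
    = (m + p * cnj m - (z1 + z2))\<^sup>2 + (of_real \<kappa> * (1 + p\<^sup>2) - 2 * of_real e * p)"
    unfolding chord_form_def by algebra
  ultimately show ?thesis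
    unfolding p_def[symmetric] using X2 
    by (simp only: of_real_diff of_real_add of_real_power diff_diff_eq) algebra
qed

lemma stretch_eq_iff:
  "a \<noteq> 0 \<Longrightarrow> b \<noteq> 0 \<Longrightarrow> stretch a b z = stretch a b w \<longleftrightarrow> z = w"
  by (auto simp: stretch_def complex_eq_iff)

lemma tangent_line_stretch_iff:
  fixes z1 z2 m :: complex and a b r :: real
  assumes "norm z1 = 1" "norm z2 = 1" "z1 \<noteq> z2" "a > 0" "b > 0" "r > 0"
  defines "\<kappa> \<equiv> r\<^sup>2 / b\<^sup>2 - r\<^sup>2 / a\<^sup>2" and "e \<equiv> r\<^sup>2 / b\<^sup>2 + r\<^sup>2 / a\<^sup>2"
  shows "tangent_line (stretch a b z1) (stretch a b z2) (stretch a b m) r \<longleftrightarrow>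
    chord_form m (cnj m) (m\<^sup>2 + of_real \<kappa>) (cnj m ^ 2 + of_real \<kappa>) (m * cnj m - of_real e) (z1 + z2) (z1 * z2) = 0"
    (is "_ \<longleftrightarrow> ?F = 0")
proof -
  define d where "d = z2 - z1"
  define X where "X = (Re z1 - Re m) * Im d - (Im z1 - Im m) * Re d"
  let ?P = "stretch a b z1" and ?Q = "stretch a b z2" and ?C = "stretch a b m"
  have "?P \<noteq> ?Q" using assms by (simp add: stretch_eq_iff)
  then have "tangent_line ?P ?Q ?C r \<longleftrightarrow>
      ((?P - ?C) \<bullet> (?Q - ?P))\<^sup>2 = (?Q - ?P) \<bullet> (?Q - ?P) * ((?P - ?C) \<bullet> (?P - ?C) - r\<^sup>2)"
    using assms by (simp add: tangent_line_iff_discriminant)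
  \<comment> \<open>By Lagrange's identity the squared cross product equals \<open>r\<^sup>2\<close>
    times the squared side length; stretching multiplies the cross product by
    \<open>a * b\<close>.\<close>
  also have "\<dots> \<longleftrightarrow> a\<^sup>2 * b\<^sup>2 * X\<^sup>2 = r\<^sup>2 * (a\<^sup>2 * (Re d)\<^sup>2 + b\<^sup>2 * (Im d)\<^sup>2)"
    unfolding stretch_def X_def d_def by (simp add: inner_prod_def) algebra
  also have "\<dots> \<longleftrightarrow> X\<^sup>2 - (e + \<kappa>) / 2 * (Re d)\<^sup>2 - (e - \<kappa>) / 2 * (Im d)\<^sup>2 = 0"
    unfolding \<kappa>_def e_def using assms(4,5) by (simp add: field_simps)
  also have "\<dots> \<longleftrightarrow> ?F = 0"
  proof -
    have "d \<noteq> 0" "z1 \<noteq> 0" "z2 \<noteq> 0" using assms by (auto simp: d_def)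
    moreover have "d\<^sup>2 * ?F = - 4 * (z1 * z2)\<^sup>2 *
        of_real (X\<^sup>2 - (e + \<kappa>) / 2 * (Re d)\<^sup>2 - (e - \<kappa>) / 2 * (Im d)\<^sup>2)"
      using chord_form_eq[OF assms(1,2), of m \<kappa> e] unfolding d_def X_def .
    ultimately show ?thesis
      by (metis (no_types, lifting) mult_eq_0_iff neg_equal_0_iff_equal of_real_eq_0_iff
          power_eq_0_iff zero_neq_numeral)
  qed
  finally show ?thesis .
qed

section \<open>Triangles whose three sides are tangent to one circle\<close>

text \<open>With \<open>z1\<close> fixed, the chord form is a quadratic in the other end with
  leading coefficient \<open>A\<close> and roots \<open>z2\<close>, \<open>z3\<close>: these are
  Vieta's formulas.\<close>

lemma chord_form_vertex:
  fixes z1 z2 z3 m m' n n' q :: complex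
  assumes "chord_form m m' n n' q (z1 + z2) (z1 * z2) = 0"
    and "chord_form m m' n n' q (z1 + z3) (z1 * z3) = 0"
    and "z2 \<noteq> z3"
  defines "A \<equiv> 1 - 2 * m' * z1 + n' * z1\<^sup>2"
  shows "A * (z2 + z3) = - (2 * z1 - 2 * m - 2 * m' * z1\<^sup>2 + 2 * q * z1)"
    and "A * (z2 * z3) = z1\<^sup>2 - 2 * m * z1 + n"
proof -
  have "(z2 - z3) * (A * (z2 + z3) + (2 * z1 - 2 * m - 2 * m' * z1\<^sup>2 + 2 * q * z1)) = 0"
    using assms(1,2) unfolding chord_form_def A_def by algebra
  then have *: "A * (z2 + z3) + (2 * z1 - 2 * m - 2 * m' * z1\<^sup>2 + 2 * q * z1) = 0"
    using assms(3) by simp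
  then show "A * (z2 + z3) = - (2 * z1 - 2 * m - 2 * m' * z1\<^sup>2 + 2 * q * z1)"
    by (rule add_eq_0_iff2[THEN iffD1])
  show "A * (z2 * z3) = z1\<^sup>2 - 2 * m * z1 + n"
    using * assms(1) unfolding chord_form_def A_def by algebra
qed

text \<open>Multiplied by its vertex, the product relation of \<open>chord_form_vertex\<close> makes
  that vertex a root of one cubic depending only on \<open>l\<close>. Three distinct roots fix the
  sum; substituting it back leaves a relation free of the vertices, the closing condition for the
  circle.\<close>

lemma chord_form_triangle:
  fixes z1 z2 z3 m m' n n' q :: complex
  assumes F: "chord_form m m' n n' q (z1 + z2) (z1 * z2) = 0"
    "chord_form m m' n n' q (z2 + z3) (z2 * z3) = 0"
    "chord_form m m' n n' q (z3 + z1) (z3 * z1) = 0"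
    and d: "z1 \<noteq> z2" "z2 \<noteq> z3" "z3 \<noteq> z1" and "z1 \<noteq> 0"
  shows "z1 + z2 + z3 = 2 * m + z1 * z2 * z3 * n'"
    and "n * n' + 1 + 2 * q = 4 * m * m'"
proof -
  define l where "l = z1 * z2 * z3"
  define S1 S2 where "S1 = 2 * m + l * n'" and "S2 = n + 2 * m' * l"
  have F': "chord_form m m' n n' q (z2 + z1) (z2 * z1) = 0"
    "chord_form m m' n n' q (z3 + z2) (z3 * z2) = 0"
    "chord_form m m' n n' q (z1 + z3) (z1 * z3) = 0"
    using F by (simp_all add: ac_simps)
  note v1 = chord_form_vertex[OF F(1) F'(3) d(2)]
  note v2 = chord_form_vertex[OF F(2) F'(1) d(3)]
  note v3 = chord_form_vertex[OF F(3) F'(2) d(1)]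
  have P1: "z1^3 - S1 * z1\<^sup>2 + S2 * z1 - l = 0"
    using v1(2) unfolding S1_def S2_def l_def by algebra
  have P2: "z2^3 - S1 * z2\<^sup>2 + S2 * z2 - l = 0"
    using v2(2) unfolding S1_def S2_def l_def by algebra
  have P3: "z3^3 - S1 * z3\<^sup>2 + S2 * z3 - l = 0"
    using v3(2) unfolding S1_def S2_def l_def by algebra
  have "(z1 - z2) * (z1\<^sup>2 + z1 * z2 + z2\<^sup>2 - S1 * (z1 + z2) + S2) = 0"
    using P1 P2 by algebra
  then have Q2: "z1\<^sup>2 + z1 * z2 + z2\<^sup>2 - S1 * (z1 + z2) + S2 = 0" using d by simp
  have "(z1 - z3) * (z1\<^sup>2 + z1 * z3 + z3\<^sup>2 - S1 * (z1 + z3) + S2) = 0"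
    using P1 P3 by algebra
  then have Q3: "z1\<^sup>2 + z1 * z3 + z3\<^sup>2 - S1 * (z1 + z3) + S2 = 0" using d by simp
  have "(z2 - z3) * (z1 + z2 + z3 - S1) = 0" using Q2 Q3 by algebra
  then have S: "z1 + z2 + z3 = S1" using d by simp
  then show "z1 + z2 + z3 = 2 * m + z1 * z2 * z3 * n'" by (simp add: S1_def l_def)
  have "z2 + z3 = S1 - z1" using S by (simp flip: S)
  then have "z1 * (n * n' + 1 + 2 * q - 4 * m * m') = 0"
    using v1 unfolding S1_def l_def by algebra
  then show "n * n' + 1 + 2 * q = 4 * m * m'" using \<open>z1 \<noteq> 0\<close> by simp
qed

text \<open>The converse direction: eliminating \<open>z3\<close> reduces the form to
  \<open>z1 * z2\<close> times the defect in the closing condition.\<close>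

lemma chord_form_eq_0:
  fixes z1 z2 z3 m m' n n' q l :: complex
  assumes "z1 + z2 + z3 = 2 * m + l * n'"
    and "z1 * z2 + z2 * z3 + z3 * z1 = n + 2 * m' * l"
    and "z1 * z2 * z3 = l"
    and "n * n' + 1 + 2 * q = 4 * m * m'"
  shows "chord_form m m' n n' q (z1 + z2) (z1 * z2) = 0"
proof -
  define s p where "s = z1 + z2" and "p = z1 * z2"
  have 1: "s = 2 * m + l * n' - z3" and 2: "p + z3 * s = n + 2 * m' * l" and 3: "p * z3 = l"
    using assms by (auto simp: s_def p_def algebra_simps)
  have "chord_form m m' n n' q s p = p * (n' * (p + z3 * s) - 2 * m' * (s + z3) + 1 + 2 * q)"
    using 1 2 3 unfolding chord_form_def by algebra
  also have "\<dots> = p * (n * n' + 1 + 2 * q - 4 * m * m')"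
    unfolding 2 using 1 by algebra
  finally show ?thesis using assms(4) by (simp add: s_def p_def)
qed

section \<open>Unit roots of the Blaschke equation\<close>

text \<open>The fundamental theorem of algebra gives one root, the quadratic formula the other two.
  Roots are listed with multiplicity; distinctness is shown separately.\<close>

lemma cubic_roots:
  fixes s1 s2 s3 :: complex
  obtains z1 z2 z3 where "z1 + z2 + z3 = s1" "z1 * z2 + z2 * z3 + z3 * z1 = s2" "z1 * z2 * z3 = s3"
proof -
  have "\<not> constant (poly [:- s3, s2, - s1, 1:])"
    by (subst constant_degree) simp
  then obtain z1 where "poly [:- s3, s2, - s1, 1:] z1 = 0"
    using fundamental_theorem_of_algebra by blast
  then have z1: "z1^3 - s1 * z1\<^sup>2 + s2 * z1 - s3 = 0"
    by (simp add: algebra_simps power2_eq_square power3_eq_cube)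
  define B D where "B = s1 - z1" and "D = s2 - z1 * B"
  define R where "R = csqrt (B\<^sup>2 - 4 * D)"
  have R: "R\<^sup>2 = B\<^sup>2 - 4 * D" by (simp add: R_def)
  have pr: "(B + R) / 2 * ((B - R) / 2) = D"
    using R by (simp add: field_simps power2_eq_square)
  show ?thesis
  proof
    show "z1 + (B + R) / 2 + (B - R) / 2 = s1" by (simp add: B_def field_simps)
    have "z1 * ((B + R) / 2) + (B - R) / 2 * z1 = z1 * B" by (simp add: field_simps)
    then show "z1 * ((B + R) / 2) + (B + R) / 2 * ((B - R) / 2) + (B - R) / 2 * z1 = s2"
      unfolding pr by (simp add: D_def algebra_simps)
    show "z1 * ((B + R) / 2) * ((B - R) / 2) = s3"
    proof -
      have "z1 * ((B + R) / 2) * ((B - R) / 2) = z1 * D"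
        unfolding mult.assoc pr ..
      also have "\<dots> = s3" unfolding D_def B_def using z1 by algebra
      finally show ?thesis .
    qed
  qed
qed

text \<open>Compares numerator and denominator of the Blaschke factor
  \<open>(z - f) / (1 - cnj f * z)\<close>: for \<open>norm f < 1\<close> the sign depends only on
  which side of the unit circle \<open>z\<close> lies.\<close>

lemma norm_diff_sq_minus_one_minus_cnj:
  "(norm (z - f))\<^sup>2 - (norm (1 - cnj f * z))\<^sup>2 = ((norm z)\<^sup>2 - 1) * (1 - (norm f)\<^sup>2)"
  unfolding cmod_power2 by (simp add: power2_eq_square algebra_simps)

text \<open>Inside the disc every factor on the left of \<open>eq\<close> is shorter than its
  partner on the right, outside it is longer, so the moduli can agree only on the circle.\<close>

lemma blaschke_root_norm:
  assumes "norm f < 1" "norm g < 1" "norm l = 1"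
    and eq: "z * (z - f) * (z - g) = l * (1 - cnj f * z) * (1 - cnj g * z)"
  shows "norm z = 1"
proof (rule ccontr)
  assume "norm z \<noteq> 1"
  have f1: "1 - (norm f)\<^sup>2 > 0" and g1: "1 - (norm g)\<^sup>2 > 0"
    using assms by (simp_all add: power_less_one_iff abs_square_less_1)
  have N: "norm z * (norm (z - f) * norm (z - g)) = norm (1 - cnj f * z) * norm (1 - cnj g * z)"
    using arg_cong[OF eq, of norm] by (simp only: norm_mult assms(3) mult.assoc mult_1)
  consider "norm z < 1" | "norm z > 1" using \<open>norm z \<noteq> 1\<close> by linarith
  then show False
  proof cases
    case 1
    then have "(norm z)\<^sup>2 - 1 < 0" by (simp add: abs_square_less_1)
    then have "(norm (z - f))\<^sup>2 < (norm (1 - cnj f * z))\<^sup>2" "(norm (z - g))\<^sup>2 < (norm (1 - cnj g * z))\<^sup>2"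
      using norm_diff_sq_minus_one_minus_cnj[of z f] norm_diff_sq_minus_one_minus_cnj[of z g] f1 g1
      by (smt (verit) mult_neg_pos)+
    then have "norm (z - f) < norm (1 - cnj f * z)" "norm (z - g) < norm (1 - cnj g * z)"
      by (auto intro: power2_less_imp_less)
    then have "norm (z - f) * norm (z - g) < norm (1 - cnj f * z) * norm (1 - cnj g * z)"
      by (intro mult_strict_mono') auto
    moreover have "norm z * (norm (z - f) * norm (z - g)) \<le> norm (z - f) * norm (z - g)"
      using 1 by (simp add: mult_left_le_one_le)
    ultimately show False using N by linarith
  next
    case 2
    then have "(norm z)\<^sup>2 - 1 > 0" by simp
    then have "(norm (z - f))\<^sup>2 > (norm (1 - cnj f * z))\<^sup>2" "(norm (z - g))\<^sup>2 > (norm (1 - cnj g * z))\<^sup>2"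
      using norm_diff_sq_minus_one_minus_cnj[of z f] norm_diff_sq_minus_one_minus_cnj[of z g] f1 g1
      by (smt (verit) mult_pos_pos)+
    then have "norm (z - f) > norm (1 - cnj f * z)" "norm (z - g) > norm (1 - cnj g * z)"
      by (auto intro: power2_less_imp_less)
    then have "norm (z - f) * norm (z - g) > norm (1 - cnj f * z) * norm (1 - cnj g * z)"
      by (intro mult_strict_mono') auto
    moreover have "norm z * (norm (z - f) * norm (z - g)) \<ge> norm (z - f) * norm (z - g)"
      using 2 by (metis less_imp_le mult_le_cancel_right1 norm_ge_zero norm_mult not_le)
    ultimately show False using N by linarith
  qed
qed

text \<open>The number below is the derivative of the difference of the two sides at the root.\<close>
lemma blaschke_root_simple:
  assumes f: "norm f < 1" and g: "norm g < 1" and z: "norm z = 1"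
    and eq: "z * (z - f) * (z - g) = l * (1 - cnj f * z) * (1 - cnj g * z)"
  shows "(z - f) * (z - g) + z * (z - g) + z * (z - f)
    + l * cnj f * (1 - cnj g * z) + l * cnj g * (1 - cnj f * z) \<noteq> 0" (is "?D \<noteq> 0")
proof
  assume D: "?D = 0"
  define u v where "u = z - f" and "v = z - g"
  have uv: "u \<noteq> 0" "v \<noteq> 0" using f g z by (auto simp: u_def v_def)
  have "z \<noteq> 0" using z by auto
  have zz: "z * cnj z = 1" using z by (simp add: mult_cnj_eq_1)
  have F: "1 - cnj f * z = z * cnj u" and G: "1 - cnj g * z = z * cnj v"
    using zz by (simp_all add: u_def v_def algebra_simps)
  have "z * (u * v) = z * (l * z * cnj u * cnj v)"
    using eq unfolding F G u_def[symmetric] v_def[symmetric] by (simp add: ac_simps)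
  then have L: "l * z * cnj u * cnj v = u * v" using \<open>z \<noteq> 0\<close> by simp
  have D': "u * v + z * v + z * u + l * cnj f * (z * cnj v) + l * cnj g * (z * cnj u) = 0"
    using D unfolding F G u_def[symmetric] v_def[symmetric] .
  have "z * cnj u + cnj f * u = 1 - f * cnj f" "z * cnj v + cnj g * v = 1 - g * cnj g"
    using zz by (simp_all add: u_def v_def algebra_simps)
  \<comment> \<open>This is the derivative times \<open>cnj u * cnj v\<close>, with \<open>l\<close>
    removed by \<open>L\<close>. All three summands are nonnegative reals and the first is
    positive.\<close>
  then have "(u * cnj u) * (v * cnj v) + (v * cnj v) * (1 - f * cnj f) + (u * cnj u) * (1 - g * cnj g) = 0"
    using D' L by algebra
  then have "complex_of_real ((norm u)\<^sup>2 * (norm v)\<^sup>2 + (norm v)\<^sup>2 * (1 - (norm f)\<^sup>2) + (norm u)\<^sup>2 * (1 - (norm g)\<^sup>2)) = 0"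
    by (simp only: of_real_add of_real_mult of_real_diff of_real_1 complex_norm_square)
  then have "(norm u)\<^sup>2 * (norm v)\<^sup>2 + (norm v)\<^sup>2 * (1 - (norm f)\<^sup>2) + (norm u)\<^sup>2 * (1 - (norm g)\<^sup>2) = 0"
    using of_real_eq_0_iff by blast
  moreover have "(norm u)\<^sup>2 * (norm v)\<^sup>2 > 0" using uv by simp
  moreover have "1 - (norm f)\<^sup>2 > 0" "1 - (norm g)\<^sup>2 > 0"
    using f g by (simp_all add: abs_square_less_1)
  then have "(norm v)\<^sup>2 * (1 - (norm f)\<^sup>2) \<ge> 0" "(norm u)\<^sup>2 * (1 - (norm g)\<^sup>2) \<ge> 0" by simp_all
  ultimately show False by linarith
qed

text \<open>Expanded, the Blaschke equation is a monic cubic whose roots have elementary symmetric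
  functions \<open>s1\<close>, \<open>s2\<close>, \<open>l\<close>. The two preceding lemmas put
  them on the circle and make them simple.\<close>

lemma blaschke_triple:
  assumes f: "norm f < 1" and g: "norm g < 1" and l: "norm l = 1"
  obtains z1 z2 z3 where "norm z1 = 1" "norm z2 = 1" "norm z3 = 1"
    "z1 \<noteq> z2" "z2 \<noteq> z3" "z3 \<noteq> z1"
    "z1 + z2 + z3 = f + g + l * (cnj f * cnj g)"
    "z1 * z2 + z2 * z3 + z3 * z1 = f * g + (cnj f + cnj g) * l"
    "z1 * z2 * z3 = l"
proof -
  define s1 s2 where "s1 = f + g + l * (cnj f * cnj g)" and "s2 = f * g + (cnj f + cnj g) * l"
  have root: "norm z = 1" "3 * z\<^sup>2 - 2 * s1 * z + s2 \<noteq> 0"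
    if "z^3 - s1 * z\<^sup>2 + s2 * z - l = 0" for z
  proof -
    have eq: "z * (z - f) * (z - g) = l * (1 - cnj f * z) * (1 - cnj g * z)"
      using that unfolding s1_def s2_def by algebra
    then show "norm z = 1" using blaschke_root_norm[OF f g l] by blast
    show "3 * z\<^sup>2 - 2 * s1 * z + s2 \<noteq> 0"
      using blaschke_root_simple[OF f g \<open>norm z = 1\<close> eq] unfolding s1_def s2_def by algebra
  qed
  obtain z1 z2 z3 where s: "z1 + z2 + z3 = s1" "z1 * z2 + z2 * z3 + z3 * z1 = s2" "z1 * z2 * z3 = l"
    using cubic_roots by metis
  have P: "z1^3 - s1 * z1\<^sup>2 + s2 * z1 - l = 0" "z2^3 - s1 * z2\<^sup>2 + s2 * z2 - l = 0"
    "z3^3 - s1 * z3\<^sup>2 + s2 * z3 - l = 0"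
    unfolding s[symmetric] by algebra+
  \<comment> \<open>In terms of the roots, the derivative at \<open>z1\<close> is
    \<open>(z1 - z2) * (z1 - z3)\<close>.\<close>
  have "z1 \<noteq> z2" using root(2)[OF P(1)] unfolding s[symmetric] by algebra
  moreover have "z2 \<noteq> z3" using root(2)[OF P(2)] unfolding s[symmetric] by algebra
  moreover have "z3 \<noteq> z1" using root(2)[OF P(3)] unfolding s[symmetric] by algebra
  ultimately show thesis
    using that[of z1 z2 z3] root(1)[OF P(1)] root(1)[OF P(2)] root(1)[OF P(3)] s
    by (simp add: s1_def s2_def)
qed

text \<open>Keeps the ellipse with foci \<open>f\<close>, \<open>g\<close> and major axis
  \<open>norm (1 - cnj f * g)\<close> inside the disc. Replacing \<open>g\<close> by
  \<open>w\<close> in \<open>1 - cnj f * g\<close> gives a number no longer than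
  \<open>w - f\<close>, and the error \<open>cnj f * (w - g)\<close> is strictly shorter than
  \<open>w - g\<close>.\<close>

lemma focal_distance_sum_gt:
  assumes f: "norm f < 1" and g: "norm g < 1" and w: "norm w \<ge> 1"
  shows "norm (1 - cnj f * g) < norm (w - f) + norm (w - g)"
proof -
  have "w \<noteq> g" using g w by auto
  have "((norm w)\<^sup>2 - 1) * (1 - (norm f)\<^sup>2) \<ge> 0"
    using f w by (intro mult_nonneg_nonneg) (simp_all add: abs_square_le_1)
  then have "(norm (1 - cnj f * w))\<^sup>2 \<le> (norm (w - f))\<^sup>2"
    using norm_diff_sq_minus_one_minus_cnj[of w f] by linarith
  then have 1: "norm (1 - cnj f * w) \<le> norm (w - f)" by (auto intro: power2_le_imp_le)
  have "1 - cnj f * g = (1 - cnj f * w) + cnj f * (w - g)" by (simp add: algebra_simps)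
  then have "norm (1 - cnj f * g) \<le> norm (1 - cnj f * w) + norm (cnj f * (w - g))"
    by (metis norm_triangle_ineq)
  also have "norm (cnj f * (w - g)) < norm (w - g)"
    using f \<open>w \<noteq> g\<close> by (simp add: norm_mult)
  finally show ?thesis using 1 by linarith
qed

section \<open>Orthocenters of stretched triangles\<close>

text \<open>In the plane all vectors orthogonal to \<open>d\<close> are multiples of its quarter
  turn. Applied to the difference of two candidate orthocenters, this gives uniqueness.\<close>

lemma collinear_if_orthogonal:
  fixes P Q R d :: point
  assumes "d \<noteq> 0" "d \<bullet> (Q - R) = 0" "d \<bullet> (R - P) = 0"
  shows "collinear {P, Q, R}"
proof -
  define u where "u = (- snd d, fst d)"
  have dd: "d \<bullet> d \<noteq> 0" using assms by simp
  have par: "\<exists>c. w = c *\<^sub>R u" if "d \<bullet> w = 0" for w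
  proof (intro exI)
    obtain w1 w2 d1 d2 where wd: "w = (w1, w2)" "d = (d1, d2)" by fastforce
    define N t where "N = d \<bullet> d" and "t = w \<bullet> u"
    have N: "N = d1 * d1 + d2 * d2" and t: "t = w2 * d1 - w1 * d2"
      by (simp_all add: N_def t_def wd u_def)
    have "d1 * w1 + d2 * w2 = 0" using that by (simp add: wd)
    then have "w1 * N = - (t * d2)" "w2 * N = t * d1" unfolding N t by algebra+
    then show "w = (t / N) *\<^sub>R u"
      using dd unfolding N_def[symmetric] by (simp add: wd u_def field_simps)
  qed
  have "d \<bullet> (x - y) = 0" if "x \<in> {P, Q, R}" "y \<in> {P, Q, R}" for x y
    using that assms(2,3) by (auto simp: inner_diff_right)
  then show ?thesis using par unfolding collinear_def by blast
qed

lemma orthocenter_eqI: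
  assumes "\<not> collinear {P, Q, R}"
    and "(H - P) \<bullet> (Q - R) = 0" "(H - Q) \<bullet> (R - P) = 0" "(H - R) \<bullet> (P - Q) = 0"
  shows "orthocenter (P, Q, R) = H"
  unfolding orthocenter_def prod.case
proof (rule the_equality)
  fix H' assume H': "(H' - P) \<bullet> (Q - R) = 0 \<and> (H' - Q) \<bullet> (R - P) = 0 \<and> (H' - R) \<bullet> (P - Q) = 0"
  show "H' = H"
  proof (rule ccontr)
    assume "H' \<noteq> H"
    moreover have "(H' - H) \<bullet> (Q - R) = 0" "(H' - H) \<bullet> (R - P) = 0"
      using H' assms(2-3) by (simp_all add: inner_diff_left)
    ultimately show False using collinear_if_orthogonal[of "H' - H" Q R P] assms(1) by simp
  qed
qed (use assms in simp)

text \<open>For \<open>a = b\<close> this is the classical vertex sum for a triangle inscribed in a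
  circle about the origin. In general the inner product is half a real part; for unit ends the terms
  with \<open>z1\<close> cancel and a difference of conjugates remains.\<close>

lemma altitude_stretch:
  fixes z1 z2 z3 :: complex and a b :: real
  assumes ab: "a > 0" "b > 0" and z: "norm z1 = 1" "norm z2 = 1" "norm z3 = 1"
  defines "W \<equiv> of_real (a\<^sup>2 + b\<^sup>2) * (z1 + z2 + z3) - of_real (a\<^sup>2 - b\<^sup>2) * (z1 * z2 * z3)"
  shows "(stretch (1 / (2 * a)) (1 / (2 * b)) W - stretch a b z1) \<bullet> (stretch a b z2 - stretch a b z3) = 0"
proof -
  have u: "z2 * cnj z2 = 1" "z3 * cnj z3 = 1" using z by (simp_all add: mult_cnj_eq_1)
  have "2 * ((stretch (1 / (2 * a)) (1 / (2 * b)) W - stretch a b z1) \<bullet> (stretch a b z2 - stretch a b z3))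
    = Re ((W - of_real (a\<^sup>2 + b\<^sup>2) * z1) * cnj (z2 - z3) - of_real (a\<^sup>2 - b\<^sup>2) * z1 * (z2 - z3))"
    using ab by (simp add: stretch_def inner_prod_def field_simps power2_eq_square)
  also have "(W - of_real (a\<^sup>2 + b\<^sup>2) * z1) * cnj (z2 - z3) - of_real (a\<^sup>2 - b\<^sup>2) * z1 * (z2 - z3)
    = of_real (a\<^sup>2 + b\<^sup>2) * (z3 * cnj z2 - z2 * cnj z3)"
    unfolding W_def complex_cnj_diff using u by algebra
  also have "Re \<dots> = 0" by simp
  finally show ?thesis by simp
qed

lemma orthocenter_stretch:
  fixes z1 z2 z3 :: complex and a b :: real
  assumes ab: "a > 0" "b > 0" and z: "norm z1 = 1" "norm z2 = 1" "norm z3 = 1"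
    and "\<not> collinear {stretch a b z1, stretch a b z2, stretch a b z3}"
  defines "W \<equiv> of_real (a\<^sup>2 + b\<^sup>2) * (z1 + z2 + z3) - of_real (a\<^sup>2 - b\<^sup>2) * (z1 * z2 * z3)"
  shows "orthocenter (stretch a b z1, stretch a b z2, stretch a b z3)
    = stretch (1 / (2 * a)) (1 / (2 * b)) W"
proof -
  have perm: "z2 + z3 + z1 = z1 + z2 + z3" "z3 + z1 + z2 = z1 + z2 + z3"
    "z2 * z3 * z1 = z1 * z2 * z3" "z3 * z1 * z2 = z1 * z2 * z3" by simp_all
  show ?thesis
    unfolding W_def
    by (rule orthocenter_eqI[OF assms(6) altitude_stretch[OF ab z]
          altitude_stretch[OF ab z(2,3,1), unfolded perm] altitude_stretch[OF ab z(3,1,2), unfolded perm]])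
qed

lemma not_collinear_stretch:
  assumes ab: "a > 0" "b > 0" and z: "norm z1 = 1" "norm z2 = 1" "norm z3 = 1"
    and d: "z1 \<noteq> z2" "z2 \<noteq> z3" "z3 \<noteq> z1"
  shows "\<not> collinear {stretch a b z1, stretch a b z2, stretch a b z3}"
proof
  assume "collinear {stretch a b z1, stretch a b z2, stretch a b z3}"
  then obtain u where "stretch a b z2 = u *\<^sub>R stretch a b z1 + (1 - u) *\<^sub>R stretch a b z3"
    using d ab by (auto simp: collinear_3_expand stretch_eq_iff)
  then have "stretch a b z2 = stretch a b (of_real u * z1 + of_real (1 - u) * z3)"
    by (simp add: stretch_def algebra_simps)
  then have z2: "z2 = of_real u * z1 + of_real (1 - u) * z3"
    using ab by (simp add: stretch_eq_iff)
  have n: "(Re z1)\<^sup>2 + (Im z1)\<^sup>2 = 1" "(Re z2)\<^sup>2 + (Im z2)\<^sup>2 = 1" "(Re z3)\<^sup>2 + (Im z3)\<^sup>2 = 1"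
    using z by (simp_all flip: cmod_power2)
  \<comment> \<open>For an affine combination of unit numbers, \<open>1 - (norm z2)\<^sup>2 = u * (1
    - u) * (norm (z1 - z3))\<^sup>2\<close>.\<close>
  have "u * (1 - u) * ((Re z1 - Re z3)\<^sup>2 + (Im z1 - Im z3)\<^sup>2) = 0"
    using n unfolding z2 by simp algebra
  then have "u = 0 \<or> u = 1 \<or> z1 = z3"
    by (auto simp: complex_eq_iff sum_power2_eq_zero_iff)
  then show False using d z2 by auto
qed

lemma ellipse_eq_stretch:
  assumes "a > 0" "b > 0"
  shows "ellipse a b = stretch a b ` sphere 0 1"
proof (intro equalityI subsetI)
  fix P assume "P \<in> ellipse a b"
  then obtain x y where P: "P = (x, y)" "x\<^sup>2 / a\<^sup>2 + y\<^sup>2 / b\<^sup>2 = 1" by (auto simp: ellipse_def)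
  then have "P = stretch a b (Complex (x / a) (y / b))" "norm (Complex (x / a) (y / b)) = 1"
    using assms by (simp_all add: stretch_def complex_norm power_divide)
  then show "P \<in> stretch a b ` sphere 0 1" by simp
qed (use assms in \<open>auto simp: ellipse_def stretch_def cmod_def power_mult_distrib\<close>)

lemma stretch_mem_interior_iff:
  assumes "a > 0" "b > 0"
  shows "stretch a b w \<in> ellipse_interior a b \<longleftrightarrow> norm w < 1"
  using assms by (simp add: ellipse_interior_def stretch_def cmod_def power_mult_distrib)

lemma stretch_surj:
  assumes "a > 0" "b > 0"
  obtains w where "P = stretch a b w"
  using that[of "Complex (fst P / a) (snd P / b)"] assms by (simp add: stretch_def)

section \<open>The nested circle with given centre\<close>

text \<open>\<open>m\<close> is the preimage of the centre under \<open>stretch a b\<close>. Only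
  \<open>c\<^sup>2\<close> is fixed; a change of sign of \<open>c\<close> exchanges the foci
  \<open>f\<close> and \<open>g\<close> below.\<close>

locale circle_center =
  fixes a b c :: real and m :: complex
  assumes b_pos: "b > 0" and b_less_a: "b < a" and c_sq: "c\<^sup>2 = a\<^sup>2 - b\<^sup>2" and m_inside: "norm m < 1"
begin

text \<open>For the centre \<open>(a * Re m, b * Im m)\<close> the two square roots in the closed
  form of the radius are \<open>a * u\<close> and \<open>b * v\<close>.\<close>

definition "u = sqrt (a\<^sup>2 - c\<^sup>2 * (Re m)\<^sup>2)"
definition "v = sqrt (b\<^sup>2 + c\<^sup>2 * (Im m)\<^sup>2)"

text \<open>The radius of the Poncelet circle is \<open>a b \<rho>\<close>; the preimage of that circle under
  \<open>stretch a b\<close> is an ellipse with foci \<open>m \<plusminus> \<i> \<rho> c\<close>.\<close>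
definition "\<rho> = (u - v) / c\<^sup>2"
definition "f = m + \<i> * of_real (\<rho> * c)"
definition "g = m - \<i> * of_real (\<rho> * c)"
text \<open>\<open>n\<close> and \<open>q\<close> are the chord form arguments for radius
  \<open>a * b * \<rho>\<close>, where \<open>\<kappa> = \<rho>\<^sup>2 * c\<^sup>2\<close> and
  \<open>e = \<rho>\<^sup>2 * (a\<^sup>2 + b\<^sup>2)\<close>.\<close>

definition "n = m\<^sup>2 + of_real (\<rho>\<^sup>2 * c\<^sup>2)"
definition "q = m * cnj m - of_real (\<rho>\<^sup>2 * (a\<^sup>2 + b\<^sup>2))"

text \<open>The closing condition for the circle of radius \<open>a b s\<close>, where \<open>t = s\<^sup>2\<close>.\<close>
definition "poncelet_cond t \<longleftrightarrow>
  ((Re m)\<^sup>2 - (Im m)\<^sup>2 + t * c\<^sup>2)\<^sup>2 + (2 * Re m * Im m)\<^sup>2 + 1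
    = 2 * ((Re m)\<^sup>2 + (Im m)\<^sup>2) + 2 * t * (a\<^sup>2 + b\<^sup>2)"

lemma a_pos: "a > 0" using b_pos b_less_a by simp

lemma c_sq_pos: "c\<^sup>2 > 0"
  unfolding c_sq using b_pos b_less_a by (simp add: power_strict_mono)

lemma m_sq: "(Re m)\<^sup>2 + (Im m)\<^sup>2 < 1"
  using m_inside by (simp add: cmod_def)

lemma u_sq: "u\<^sup>2 = a\<^sup>2 - c\<^sup>2 * (Re m)\<^sup>2"
proof -
  have "(Re m)\<^sup>2 \<le> 1" using m_sq by (smt (verit) zero_le_power2)
  then have "c\<^sup>2 * (Re m)\<^sup>2 \<le> c\<^sup>2" using c_sq_pos by (simp add: mult_left_le)
  then have "0 \<le> a\<^sup>2 - c\<^sup>2 * (Re m)\<^sup>2" using c_sq by (smt (verit) zero_le_power2)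
  then show ?thesis by (simp add: u_def)
qed

lemma v_sq: "v\<^sup>2 = b\<^sup>2 + c\<^sup>2 * (Im m)\<^sup>2"
  by (simp add: v_def)

lemma v_pos: "v > 0"
  using b_pos by (simp add: v_def add_pos_nonneg)

lemma v_less_u: "v < u"
proof -
  have "u\<^sup>2 - v\<^sup>2 = c\<^sup>2 * (1 - ((Re m)\<^sup>2 + (Im m)\<^sup>2))"
    unfolding u_sq v_sq using c_sq by algebra
  also have "\<dots> > 0" using m_sq c_sq_pos by simp
  finally have "v\<^sup>2 < u\<^sup>2" by simp
  moreover have "u \<ge> 0" using u_sq unfolding u_def
    by (metis real_sqrt_ge_zero zero_le_power2 u_def)
  ultimately show ?thesis by (rule power2_less_imp_less)
qed

lemma rho_pos: "\<rho> > 0"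
  using v_less_u c_sq_pos by (simp add: \<rho>_def)

lemma rho_eq: "\<rho> * c\<^sup>2 = u - v"
  using c_sq_pos by (simp add: \<rho>_def)

text \<open>Of the two solutions only the smaller belongs to a circle inside the ellipse.\<close>
lemma poncelet_cond_iff:
  "poncelet_cond t \<longleftrightarrow> c^4 * t = (u - v)\<^sup>2 \<or> c^4 * t = (u + v)\<^sup>2"
proof -
  \<comment> \<open>The closing condition is quadratic in \<open>t\<close> and factors once
    \<open>u\<^sup>2\<close> and \<open>v\<^sup>2\<close> are expanded.\<close>
  have "(c^4 * t - (u - v)\<^sup>2) * (c^4 * t - (u + v)\<^sup>2)
    = c^4 * (((Re m)\<^sup>2 - (Im m)\<^sup>2 + t * c\<^sup>2)\<^sup>2 + (2 * Re m * Im m)\<^sup>2 + 1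
     - (2 * ((Re m)\<^sup>2 + (Im m)\<^sup>2) + 2 * t * (a\<^sup>2 + b\<^sup>2)))"
    using u_sq v_sq c_sq by algebra
  moreover have "c^4 \<noteq> 0" using c_sq_pos by auto
  ultimately show ?thesis
    unfolding poncelet_cond_def by (metis (no_types, lifting) eq_iff_diff_eq_0 mult_eq_0_iff)
qed

lemma poncelet_cond_rho: "poncelet_cond (\<rho>\<^sup>2)"
  unfolding poncelet_cond_iff using rho_eq by (intro disjI1) algebra

text \<open>Nesting gives \<open>c^4 * t < a\<^sup>2 * (1 - (Re m)\<^sup>2) \<le> u\<^sup>2\<close>,
  which excludes the larger value \<open>(u + v)\<^sup>2\<close>.\<close>

lemma poncelet_cond_nested:
  assumes "poncelet_cond t" and nested: "(Re m)\<^sup>2 + (Im m)\<^sup>2 + a\<^sup>2 * t < 1" and "t > 0"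
  shows "t = \<rho>\<^sup>2"
proof -
  have "c^4 * t \<noteq> (u + v)\<^sup>2"
  proof
    assume *: "c^4 * t = (u + v)\<^sup>2"
    have "c\<^sup>2 \<le> a\<^sup>2" using c_sq by simp
    then have "(c\<^sup>2)\<^sup>2 \<le> (a\<^sup>2)\<^sup>2" by (rule power_mono) simp
    then have "c^4 \<le> a^4" by (simp only: flip: power_mult) (simp only: mult_2 numeral_plus_numeral add_num_simps)
    then have "c^4 * t \<le> a^4 * t" using \<open>t > 0\<close> by (intro mult_right_mono) auto
    also have "a^4 * t = a\<^sup>2 * (a\<^sup>2 * t)" by (simp add: power4_eq_xxxx power2_eq_square)
    also have "\<dots> < a\<^sup>2 * (1 - (Re m)\<^sup>2)"
      using nested a_pos by (intro mult_strict_left_mono) (smt (verit) zero_le_power2, simp)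
    also have "\<dots> \<le> u\<^sup>2"
      unfolding u_sq using \<open>c\<^sup>2 \<le> a\<^sup>2\<close> by (simp add: right_diff_distrib mult_right_mono)
    also have "\<dots> \<le> (u + v)\<^sup>2"
      using v_pos v_less_u by (intro power_mono) auto
    finally show False using * by simp
  qed
  then have "c^4 * t = (u - v)\<^sup>2" using assms(1) poncelet_cond_iff by blast
  then have "c^4 * t = c^4 * \<rho>\<^sup>2" unfolding rho_eq[symmetric] by algebra
  then show ?thesis using c_sq_pos by auto
qed

text \<open>Links the real condition to the closing relation produced by
  \<open>chord_form_triangle\<close>: the difference of the complex sides is real.\<close>

lemma poncelet_cond_iff_complex:
  "poncelet_cond t \<longleftrightarrow>
    (m\<^sup>2 + of_real (t * c\<^sup>2)) * ((cnj m)\<^sup>2 + of_real (t * c\<^sup>2)) + 1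
      + 2 * (m * cnj m - of_real (t * (a\<^sup>2 + b\<^sup>2))) = 4 * m * cnj m"
  (is "_ \<longleftrightarrow> ?l = ?r")
proof -
  have "?l - ?r = of_real (((Re m)\<^sup>2 - (Im m)\<^sup>2 + t * c\<^sup>2)\<^sup>2 + (2 * Re m * Im m)\<^sup>2 + 1
      - (2 * ((Re m)\<^sup>2 + (Im m)\<^sup>2) + 2 * t * (a\<^sup>2 + b\<^sup>2)))"
    by (simp add: complex_eq_iff power2_eq_square algebra_simps)
  then have "?l - ?r = 0 \<longleftrightarrow> poncelet_cond t"
    unfolding poncelet_cond_def by (simp only: of_real_eq_0_iff) simp
  then show ?thesis by simp
qed

lemma cond_complex: "n * cnj n + 1 + 2 * q = 4 * m * cnj m"
  using poncelet_cond_rho unfolding poncelet_cond_iff_complex n_def q_def by simp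

lemma foci_sum: "f + g = 2 * m" and foci_prod: "f * g = n"
  by (simp_all add: f_def g_def n_def complex_eq_iff power2_eq_square algebra_simps)

text \<open>The numbers \<open>?A\<close> and \<open>?B\<close> have positive product by the closing
  condition, and positive sum because \<open>\<rho> * c\<^sup>2 = u - v < u + v\<close>.\<close>

lemma foci_inside: "norm f < 1" "norm g < 1"
proof -
  let ?A = "1 - (norm f)\<^sup>2" and ?B = "1 - (norm g)\<^sup>2"
  have "?A * ?B = 4 * \<rho>\<^sup>2 * b\<^sup>2"
    using poncelet_cond_rho c_sq unfolding poncelet_cond_def cmod_power2 f_def g_def
    by simp algebra
  then have prod: "?A * ?B > 0" using rho_pos b_pos by simp
  have "?A + ?B = 2 * (1 - ((Re m)\<^sup>2 + (Im m)\<^sup>2) - \<rho>\<^sup>2 * c\<^sup>2)"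
    unfolding cmod_power2 f_def g_def by simp algebra
  moreover have "\<rho>\<^sup>2 * c\<^sup>2 < 1 - ((Re m)\<^sup>2 + (Im m)\<^sup>2)"
  proof -
    have "c\<^sup>2 * (\<rho>\<^sup>2 * c\<^sup>2) = (u - v) * (u - v)"
      using rho_eq by algebra
    also have "\<dots> < (u - v) * (u + v)"
      using v_less_u v_pos by (intro mult_strict_left_mono) auto
    also have "\<dots> = c\<^sup>2 * (1 - ((Re m)\<^sup>2 + (Im m)\<^sup>2))"
      using u_sq v_sq c_sq by algebra
    finally show ?thesis using c_sq_pos by simp
  qed
  ultimately have "?A + ?B > 0" by simp
  with prod have "?A > 0 \<and> ?B > 0"
    by (smt (verit) zero_less_mult_iff)
  then show "norm f < 1" "norm g < 1" by (simp_all add: abs_square_less_1)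
qed

lemma major_axis: "norm (1 - cnj f * g) = 2 * a * \<rho>"
proof (rule power2_eq_imp_eq)
  show "(norm (1 - cnj f * g))\<^sup>2 = (2 * a * \<rho>)\<^sup>2"
    using poncelet_cond_rho c_sq unfolding poncelet_cond_def cmod_power2 f_def g_def
    by simp algebra
qed (use a_pos rho_pos in auto)

text \<open>The classical linear formula: a focal distance is the semi-major axis
  \<open>a * \<rho>\<close> minus the eccentricity times the coordinate along the major axis. The
  values \<open>k = c\<close> and \<open>k = - c\<close> serve the two foci.\<close>

lemma focal_distances:
  assumes "a\<^sup>2 * (Re d)\<^sup>2 + b\<^sup>2 * (Im d)\<^sup>2 = (a * b * \<rho>)\<^sup>2" and k: "k\<^sup>2 = c\<^sup>2"
  shows "norm (d - \<i> * of_real (\<rho> * k)) = a * \<rho> - k / a * Im d"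
proof (rule power2_eq_imp_eq)
  have "(norm (d - \<i> * of_real (\<rho> * k)))\<^sup>2 = (Re d)\<^sup>2 + (Im d - \<rho> * k)\<^sup>2"
    by (simp add: cmod_power2)
  then have "a\<^sup>2 * (norm (d - \<i> * of_real (\<rho> * k)))\<^sup>2 = (a * (a * \<rho>) - k * Im d)\<^sup>2"
    using assms c_sq by algebra
  also have "a * (a * \<rho>) - k * Im d = a * (a * \<rho> - k / a * Im d)"
    using a_pos by (simp add: right_diff_distrib)
  also have "\<dots>\<^sup>2 = a\<^sup>2 * (a * \<rho> - k / a * Im d)\<^sup>2"
    by (rule power_mult_distrib)
  finally show "(norm (d - \<i> * of_real (\<rho> * k)))\<^sup>2 = (a * \<rho> - k / a * Im d)\<^sup>2"
    using a_pos by simp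
  have "0 \<le> a\<^sup>2 * (Re d)\<^sup>2" by simp
  with assms(1) have "b\<^sup>2 * (Im d)\<^sup>2 \<le> (a * b * \<rho>)\<^sup>2" by linarith
  also have "\<dots> = b\<^sup>2 * (a * \<rho>)\<^sup>2" by (simp add: power_mult_distrib)
  finally have "b\<^sup>2 * (Im d)\<^sup>2 \<le> b\<^sup>2 * (a * \<rho>)\<^sup>2" .
  then have "(Im d)\<^sup>2 \<le> (a * \<rho>)\<^sup>2" using b_pos by simp
  moreover have "k\<^sup>2 \<le> a\<^sup>2" using k c_sq by simp
  ultimately have "(k * Im d)\<^sup>2 \<le> (a * (a * \<rho>))\<^sup>2"
    unfolding power_mult_distrib[of k] power_mult_distrib[of a "a * \<rho>"] by (intro mult_mono) auto
  then have "k * Im d \<le> a * (a * \<rho>)"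
    using a_pos rho_pos by (intro power2_le_imp_le[of "k * Im d"]) auto
  then show "0 \<le> a * \<rho> - k / a * Im d" using a_pos by (simp add: field_simps)
qed simp

text \<open>On the preimage of the circle the focal distances add up to
  \<open>norm (1 - cnj f * g)\<close>, less than at any point with
  \<open>norm w \<ge> 1\<close>.\<close>

lemma circle_nested: "sphere (stretch a b m) (a * b * \<rho>) \<subseteq> ellipse_interior a b"
proof
  fix P assume P: "P \<in> sphere (stretch a b m) (a * b * \<rho>)"
  obtain w where w: "P = stretch a b w" using stretch_surj a_pos b_pos by metis
  define d where "d = w - m"
  have "(a * b * \<rho>)\<^sup>2 = (dist (stretch a b m) P)\<^sup>2" using P by simp
  also have "\<dots> = a\<^sup>2 * (Re d)\<^sup>2 + b\<^sup>2 * (Im d)\<^sup>2"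
    unfolding w stretch_def d_def dist_Pair_Pair by (simp add: dist_real_def) algebra
  finally have d: "a\<^sup>2 * (Re d)\<^sup>2 + b\<^sup>2 * (Im d)\<^sup>2 = (a * b * \<rho>)\<^sup>2" ..
  have "w - f = d - \<i> * of_real (\<rho> * c)" "w - g = d - \<i> * of_real (\<rho> * - c)"
    by (simp_all add: d_def f_def g_def)
  then have "norm (w - f) + norm (w - g) = norm (1 - cnj f * g)"
    using focal_distances[OF d, of c] focal_distances[OF d, of "- c"] major_axis by simp
  then have "norm w < 1"
    using focal_distance_sum_gt[OF foci_inside, of w] by linarith
  then show "P \<in> ellipse_interior a b"
    using w stretch_mem_interior_iff a_pos b_pos by simp
qed

lemma tangent_line_iff_chord:
  assumes "norm z1 = 1" "norm z2 = 1" "z1 \<noteq> z2" "s > 0"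
  shows "tangent_line (stretch a b z1) (stretch a b z2) (stretch a b m) (a * b * s) \<longleftrightarrow>
    chord_form m (cnj m) (m\<^sup>2 + of_real (s\<^sup>2 * c\<^sup>2)) ((cnj m)\<^sup>2 + of_real (s\<^sup>2 * c\<^sup>2))
      (m * cnj m - of_real (s\<^sup>2 * (a\<^sup>2 + b\<^sup>2))) (z1 + z2) (z1 * z2) = 0"
proof -
  have "(a * b * s)\<^sup>2 / b\<^sup>2 - (a * b * s)\<^sup>2 / a\<^sup>2 = s\<^sup>2 * c\<^sup>2"
    "(a * b * s)\<^sup>2 / b\<^sup>2 + (a * b * s)\<^sup>2 / a\<^sup>2 = s\<^sup>2 * (a\<^sup>2 + b\<^sup>2)"
    using a_pos b_pos by (simp_all add: c_sq power_mult_distrib algebra_simps)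
  then show ?thesis
    using tangent_line_stretch_iff[OF assms(1-3) a_pos b_pos, of "a * b * s" m] assms(4) a_pos b_pos
    by simp
qed

text \<open>Tests nesting at the highest and lowest points of the circle and adds the two
  inequalities, which cancels the term linear in \<open>Im m\<close>.\<close>

lemma nested_bound:
  assumes "s > 0" "sphere (stretch a b m) (a * b * s) \<subseteq> ellipse_interior a b"
  shows "(Re m)\<^sup>2 + (Im m)\<^sup>2 + a\<^sup>2 * s\<^sup>2 < 1"
proof -
  have "stretch a b (m + \<i> * of_real t) \<in> sphere (stretch a b m) (a * b * s)" if "\<bar>t\<bar> = a * s" for t
  proof -
    have "dist (stretch a b m) (stretch a b (m + \<i> * of_real t)) = b * \<bar>t\<bar>"
      using b_pos by (simp add: stretch_def dist_Pair_Pair dist_real_def algebra_simps abs_mult real_sqrt_mult)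
    then show ?thesis using that by simp
  qed
  from this[of "a * s"] this[of "- (a * s)"]
  have "norm (m + \<i> * of_real (a * s)) < 1" "norm (m + \<i> * of_real (- (a * s))) < 1"
    using assms a_pos b_pos by (auto simp del: of_real_mult simp flip: stretch_mem_interior_iff[OF a_pos b_pos])
  then have "(norm (m + \<i> * of_real (a * s)))\<^sup>2 < 1" "(norm (m + \<i> * of_real (- (a * s))))\<^sup>2 < 1"
    by (simp_all add: abs_square_less_1)
  then have "(Re m)\<^sup>2 + (Im m + a * s)\<^sup>2 < 1" "(Re m)\<^sup>2 + (Im m - a * s)\<^sup>2 < 1"
    by (simp_all add: cmod_power2)
  then show ?thesis by (simp add: power2_eq_square algebra_simps)
qed

section \<open>The locus as the stretched image of a circle\<close>

text \<open>The coefficient of \<open>l\<close> in the orthocenter formula once the vertex sum is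
  written as \<open>2 * m + l * cnj n\<close>; its modulus is the radius of the circle traced before
  stretching.\<close>

definition "K = of_real (a\<^sup>2 + b\<^sup>2) * cnj n - of_real (c\<^sup>2)"

lemma orthocenter_locus_eq:
  "orthocenter_locus a b (stretch a b m) =
    (\<lambda>l. stretch (1 / (2 * a)) (1 / (2 * b)) (of_real (a\<^sup>2 + b\<^sup>2) * (2 * m) + l * K)) ` sphere 0 1"
    (is "_ = ?h ` _")
proof (intro equalityI subsetI)
  fix H assume "H \<in> orthocenter_locus a b (stretch a b m)"
  then obtain P Q R r where H: "H = orthocenter (P, Q, R)" and nc: "\<not> collinear {P, Q, R}"
    and PQR: "{P, Q, R} \<subseteq> ellipse a b" and r: "r > 0"
    and nest: "sphere (stretch a b m) r \<subseteq> ellipse_interior a b"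
    and tan: "tangent_line P Q (stretch a b m) r" "tangent_line Q R (stretch a b m) r"
      "tangent_line R P (stretch a b m) r"
    by (auto simp: orthocenter_locus_def poncelet_family_def)
  obtain z1 z2 z3 where P: "P = stretch a b z1" and Q: "Q = stretch a b z2" and R: "R = stretch a b z3"
    and z: "norm z1 = 1" "norm z2 = 1" "norm z3 = 1"
    using PQR ellipse_eq_stretch[OF a_pos b_pos] by auto
  have d: "z1 \<noteq> z2" "z2 \<noteq> z3" "z3 \<noteq> z1"
    using nc unfolding P Q R by (auto simp: insert_commute)
  define s where "s = r / (a * b)"
  have s: "s > 0" "r = a * b * s" using r a_pos b_pos by (simp_all add: s_def)
  note chord = tan[unfolded P Q R s(2) tangent_line_iff_chord[OF z(1,2) d(1) s(1)]
      tangent_line_iff_chord[OF z(2,3) d(2) s(1)] tangent_line_iff_chord[OF z(3,1) d(3) s(1)]]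
  have "z1 \<noteq> 0" using z by auto
  note tri = chord_form_triangle[OF chord d this]
  \<comment> \<open>The family leaves the radius open; closing condition and nesting together
    determine it.\<close>
  have "s\<^sup>2 = \<rho>\<^sup>2"
  proof (rule poncelet_cond_nested)
    show "poncelet_cond (s\<^sup>2)"
      unfolding poncelet_cond_iff_complex by (rule tri(2))
    show "(Re m)\<^sup>2 + (Im m)\<^sup>2 + a\<^sup>2 * s\<^sup>2 < 1"
      using nested_bound[OF s(1)] nest s(2) by blast
  qed (use s in simp)
  then have "(cnj m)\<^sup>2 + of_real (s\<^sup>2 * c\<^sup>2) = cnj n" by (simp add: n_def)
  then have sum: "z1 + z2 + z3 = 2 * m + z1 * z2 * z3 * cnj n" using tri(1) by simp
  have "H = ?h (z1 * z2 * z3)"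
    unfolding H P Q R orthocenter_stretch[OF a_pos b_pos z nc[unfolded P Q R]] sum K_def c_sq
    by (intro arg_cong[where f = "stretch _ _"]) algebra
  moreover have "norm (z1 * z2 * z3) = 1" using z by (simp add: norm_mult)
  ultimately show "H \<in> ?h ` sphere 0 1" by auto
next
  fix H assume "H \<in> ?h ` sphere 0 1"
  then obtain l where H: "H = ?h l" and l: "norm l = 1" by auto
  obtain z1 z2 z3 where z: "norm z1 = 1" "norm z2 = 1" "norm z3 = 1"
    and d: "z1 \<noteq> z2" "z2 \<noteq> z3" "z3 \<noteq> z1"
    and s: "z1 + z2 + z3 = f + g + l * (cnj f * cnj g)"
      "z1 * z2 + z2 * z3 + z3 * z1 = f * g + (cnj f + cnj g) * l"
      "z1 * z2 * z3 = l"
    using blaschke_triple[OF foci_inside l] by metis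
  have s': "z1 + z2 + z3 = 2 * m + l * cnj n"
    "z1 * z2 + z2 * z3 + z3 * z1 = n + 2 * cnj m * l"
    using s(1,2) unfolding complex_cnj_mult[symmetric] complex_cnj_add[symmetric] foci_sum foci_prod
    by simp_all
  have n': "(cnj m)\<^sup>2 + of_real (\<rho>\<^sup>2 * c\<^sup>2) = cnj n" by (simp add: n_def)
  \<comment> \<open>Stated for generic ends \<open>x\<close>, \<open>y\<close> and third vertex
    \<open>w\<close>, so that cyclic permutation covers all three sides.\<close>
  have tan: "tangent_line (stretch a b x) (stretch a b y) (stretch a b m) (a * b * \<rho>)"
    if "norm x = 1" "norm y = 1" "x \<noteq> y" "x + y + w = 2 * m + l * cnj n"
      "x * y + y * w + w * x = n + 2 * cnj m * l" "x * y * w = l" for x y w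
    unfolding tangent_line_iff_chord[OF that(1-3) rho_pos] n' n_def[symmetric] q_def[symmetric]
    using chord_form_eq_0[OF that(4-6) cond_complex] .
  let ?T = "(stretch a b z1, stretch a b z2, stretch a b z3)"
  note nc = not_collinear_stretch[OF a_pos b_pos z d]
  have "?T \<in> poncelet_family a b (stretch a b m)"
    unfolding poncelet_family_def mem_Collect_eq prod.case
  proof (intro conjI exI[of _ "a * b * \<rho>"])
    show "{stretch a b z1, stretch a b z2, stretch a b z3} \<subseteq> ellipse a b"
      using z by (simp add: ellipse_eq_stretch[OF a_pos b_pos])
    show "tangent_line (stretch a b z1) (stretch a b z2) (stretch a b m) (a * b * \<rho>)"
      using tan[OF z(1,2) d(1) s' s(3)] .
    show "tangent_line (stretch a b z2) (stretch a b z3) (stretch a b m) (a * b * \<rho>)"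
      by (rule tan[OF z(2,3) d(2), of z1]) (use s' s(3) in \<open>simp_all add: ac_simps\<close>)
    show "tangent_line (stretch a b z3) (stretch a b z1) (stretch a b m) (a * b * \<rho>)"
      by (rule tan[OF z(3,1) d(3), of z2]) (use s' s(3) in \<open>simp_all add: ac_simps\<close>)
  qed (use a_pos b_pos rho_pos circle_nested nc in auto)
  moreover have "orthocenter ?T = H"
    unfolding H orthocenter_stretch[OF a_pos b_pos z nc] s'(1) s(3) K_def c_sq
    by (intro arg_cong[where f = "stretch _ _"]) algebra
  ultimately show "H \<in> orthocenter_locus a b (stretch a b m)"
    unfolding orthocenter_locus_def by (metis imageI)
qed

text \<open>The right side is \<open>4 * z\<^sub>4\<close> for the centre
  \<open>stretch a b m\<close>, with \<open>\<delta> = a * b * u * v\<close>.\<close>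

lemma norm_K_sq:
  "a\<^sup>2 * b\<^sup>2 * c^4 * (norm K)\<^sup>2 = 4 * ((a\<^sup>2 + b\<^sup>2) * (a^8 * (b * Im m)\<^sup>2 + b^8 * (a * Re m)\<^sup>2 - 4 * a^3 * b^3 * (a * b * u * v))
    + a^8 * b^4 + a^6 * b^4 * (6 * b\<^sup>2 - ((a * Re m)\<^sup>2 + (b * Im m)\<^sup>2))
    + a^4 * b^6 * (b\<^sup>2 - ((a * Re m)\<^sup>2 + (b * Im m)\<^sup>2)))"
proof -
  let ?S = "a\<^sup>2 + b\<^sup>2"
  have R: "\<rho>\<^sup>2 * c^4 = u\<^sup>2 + v\<^sup>2 - 2 * (u * v)" using rho_eq by algebra
  have "(norm K)\<^sup>2 = (?S * ((Re m)\<^sup>2 - (Im m)\<^sup>2 + \<rho>\<^sup>2 * c\<^sup>2) - c\<^sup>2)\<^sup>2 + (?S * (2 * Re m * Im m))\<^sup>2"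
    unfolding K_def n_def cmod_power2 by (simp add: power2_eq_square algebra_simps)
  \<comment> \<open>The closing condition replaces the squared modulus of \<open>n\<close>, so that
    \<open>\<rho>\<^sup>2\<close> enters only linearly, with
    \<open>?S\<^sup>2 - c^4 = 4 * a\<^sup>2 * b\<^sup>2\<close> in its coefficient.\<close>
  also have "\<dots> = ?S\<^sup>2 * (2 * ((Re m)\<^sup>2 + (Im m)\<^sup>2) - 1) - 2 * ?S * c\<^sup>2 * ((Re m)\<^sup>2 - (Im m)\<^sup>2)
      + c^4 + 8 * ?S * a\<^sup>2 * b\<^sup>2 * \<rho>\<^sup>2"
    using poncelet_cond_rho c_sq unfolding poncelet_cond_def by algebra
  finally have "c^4 * (norm K)\<^sup>2 = c^4 * (?S\<^sup>2 * (2 * ((Re m)\<^sup>2 + (Im m)\<^sup>2) - 1)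
      - 2 * ?S * c\<^sup>2 * ((Re m)\<^sup>2 - (Im m)\<^sup>2) + c^4) + 8 * ?S * a\<^sup>2 * b\<^sup>2 * (u\<^sup>2 + v\<^sup>2 - 2 * (u * v))"
    using R by algebra
  \<comment> \<open>Only even powers and the product \<open>u * v\<close> remain, so these five
    variables give a polynomial identity of much lower degree.\<close>
  moreover define A B X Y w where "A = a\<^sup>2" and "B = b\<^sup>2" and "X = (Re m)\<^sup>2" and "Y = (Im m)\<^sup>2"
    and "w = u * v"
  moreover have "c^4 = (A - B)\<^sup>2" "a^8 = A^4" "b^8 = B^4" "a^6 = A^3" "b^6 = B^3" "a^4 = A\<^sup>2" "b^4 = B\<^sup>2"
    using c_sq unfolding A_def B_def by algebra+
  moreover have "a^3 * b^3 * (a * b * u * v) = A\<^sup>2 * B\<^sup>2 * w"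
    unfolding A_def B_def w_def by (simp add: eval_nat_numeral)
  ultimately have "c^4 * (norm K)\<^sup>2 = (A - B)\<^sup>2 * ((A + B)\<^sup>2 * (2 * (X + Y) - 1)
      - 2 * (A + B) * (A - B) * (X - Y) + (A - B)\<^sup>2)
      + 8 * (A + B) * A * B * ((A - (A - B) * X) + (B + (A - B) * Y) - 2 * w)"
    and pw: "a^8 = A^4" "b^8 = B^4" "a^6 = A^3" "b^6 = B^3" "a^4 = A\<^sup>2" "b^4 = B\<^sup>2"
    "4 * a^3 * b^3 * (a * b * u * v) = 4 * (A\<^sup>2 * B\<^sup>2 * w)"
    by (simp_all only: u_sq v_sq c_sq mult.assoc)
  then have "a\<^sup>2 * b\<^sup>2 * c^4 * (norm K)\<^sup>2 = A * B * ((A - B)\<^sup>2 * ((A + B)\<^sup>2 * (2 * (X + Y) - 1)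
      - 2 * (A + B) * (A - B) * (X - Y) + (A - B)\<^sup>2)
      + 8 * (A + B) * A * B * ((A - (A - B) * X) + (B + (A - B) * Y) - 2 * w))"
    unfolding mult.assoc A_def[symmetric] B_def[symmetric] by simp
  also have "\<dots> = 4 * ((A + B) * (A^4 * (B * Y) + B^4 * (A * X) - 4 * (A\<^sup>2 * B\<^sup>2 * w))
      + A^4 * B\<^sup>2 + A^3 * B\<^sup>2 * (6 * B - (A * X + B * Y)) + A\<^sup>2 * B^3 * (B - (A * X + B * Y)))"
    by algebra
  finally show ?thesis
    unfolding pw power_mult_distrib A_def[symmetric] B_def[symmetric] X_def[symmetric] Y_def[symmetric]
    .
qed

end

section \<open>Parametrisation of the locus and its semi-axes\<close>

text \<open>The cosine sits on the imaginary part because \<open>ellipse_with_semiaxes\<close> pairs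
  it with the major axis, which is vertical for the locus.\<close>

lemma image_mult_sphere:
  fixes k :: complex
  shows "(\<lambda>l. l * k) ` sphere 0 1 = range (\<lambda>t. of_real (norm k) * Complex (sin t) (cos t))"
proof (intro equalityI subsetI)
  fix w assume "w \<in> (\<lambda>l. l * k) ` sphere 0 1"
  then have "norm w = norm k" by (auto simp: norm_mult)
  \<comment> \<open>The factor \<open>\<i>\<close> swaps the roles of sine and cosine; the remaining
    minus sign is absorbed by \<open>pi - t\<close>.\<close>
  obtain t where t: "w * \<i> = of_real (norm w) * cis t" by (metis norm_mult norm_ii mult_1_right rcis_def rcis_cmod_Arg)
  then have "w = of_real (norm k) * Complex (sin t) (- cos t)"
    using \<open>norm w = norm k\<close> by (auto simp: complex_eq_iff)
  then have "w = of_real (norm k) * Complex (sin (pi - t)) (cos (pi - t))"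
    by simp
  then show "w \<in> range (\<lambda>t. of_real (norm k) * Complex (sin t) (cos t))" by blast
next
  fix w assume "w \<in> range (\<lambda>t. of_real (norm k) * Complex (sin t) (cos t))"
  then obtain t where w: "w = of_real (norm k) * Complex (sin t) (cos t)" by blast
  then have "norm w = norm k" by (simp add: norm_mult complex_norm)
  then show "w \<in> (\<lambda>l. l * k) ` sphere 0 1"
  proof (cases "k = 0")
    case True
    then show ?thesis using w by (auto intro!: image_eqI[of _ _ 1])
  next
    case False
    then show ?thesis using \<open>norm w = norm k\<close>
      by (intro image_eqI[of _ _ "w / k"]) (simp_all add: norm_divide)
  qed
qed

theorem proposition4:
  fixes a b c x\<^sub>c y\<^sub>c \<delta> z\<^sub>4 z\<^sub>4' :: real
  assumes "a > b" and "b > 0"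
    and "c\<^sup>2 = a\<^sup>2 - b\<^sup>2"
    and "(x\<^sub>c, y\<^sub>c) \<in> ellipse_interior a b"
    and "\<delta> = sqrt ((b^4 + c\<^sup>2 * y\<^sub>c\<^sup>2) * (a^4 - c\<^sup>2 * x\<^sub>c\<^sup>2))"
    and "z\<^sub>4' = x\<^sub>c\<^sup>2 + y\<^sub>c\<^sup>2"
    and "z\<^sub>4 = (a\<^sup>2 + b\<^sup>2) * (a^8 * y\<^sub>c\<^sup>2 + b^8 * x\<^sub>c\<^sup>2 - 4 * a^3 * b^3 * \<delta>)
               + a^8 * b^4 + a^6 * b^4 * (6 * b\<^sup>2 - z\<^sub>4') + a^4 * b^6 * (b\<^sup>2 - z\<^sub>4')"
  shows "\<exists>a\<^sub>4 b\<^sub>4. ellipse_with_semiaxes (orthocenter_locus a b (x\<^sub>c, y\<^sub>c)) a\<^sub>4 b\<^sub>4 \<and>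
           a\<^sub>4\<^sup>2 = z\<^sub>4 / (a\<^sup>2 * b^4 * c^4) \<and> b\<^sub>4\<^sup>2 = z\<^sub>4 / (b\<^sup>2 * a^4 * c^4)"
proof -
  have a: "a > 0" using assms by simp
  obtain m where m: "(x\<^sub>c, y\<^sub>c) = stretch a b m" using stretch_surj[OF a \<open>b > 0\<close>] by metis
  then have xy: "x\<^sub>c = a * Re m" "y\<^sub>c = b * Im m" by (simp_all add: stretch_def)
  have "norm m < 1" using assms(4) stretch_mem_interior_iff[OF a \<open>b > 0\<close>] unfolding m by simp
  then interpret circle_center a b c m using assms by unfold_locales auto
  have \<delta>: "\<delta> = a * b * u * v"
  proof -
    have "(b^4 + c\<^sup>2 * y\<^sub>c\<^sup>2) * (a^4 - c\<^sup>2 * x\<^sub>c\<^sup>2) = (a * b * u * v)\<^sup>2"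
      unfolding power_mult_distrib u_sq v_sq xy by algebra
    then show ?thesis
      using assms(5) a \<open>b > 0\<close> v_pos v_less_u by simp
  qed
  have K: "a\<^sup>2 * b\<^sup>2 * c^4 * (norm K)\<^sup>2 = 4 * z\<^sub>4"
    unfolding assms(7) assms(6) \<delta> xy by (rule norm_K_sq)
  \<comment> \<open>Stretching the circle of radius \<open>norm K\<close> gives these semi-axes;
    since \<open>b < a\<close>, the vertical one is the major one.\<close>
  define p where "p = norm K / (2 * b)"
  define s where "s = norm K / (2 * a)"
  have c: "c \<noteq> 0" using c_sq_pos by auto
  have axes: "p\<^sup>2 = z\<^sub>4 / (a\<^sup>2 * b^4 * c^4)" "s\<^sup>2 = z\<^sub>4 / (b\<^sup>2 * a^4 * c^4)"
  proof -
    have z: "z\<^sub>4 = a\<^sup>2 * b\<^sup>2 * c^4 * (norm K)\<^sup>2 / 4" using K by simp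
    show "p\<^sup>2 = z\<^sub>4 / (a\<^sup>2 * b^4 * c^4)" "s\<^sup>2 = z\<^sub>4 / (b\<^sup>2 * a^4 * c^4)"
      unfolding z p_def s_def using a \<open>b > 0\<close> c
      by (simp_all add: field_simps power2_eq_square power4_eq_xxxx)
  qed
  define M where "M = stretch (1 / (2 * a)) (1 / (2 * b)) (of_real (a\<^sup>2 + b\<^sup>2) * (2 * m))"
  have "orthocenter_locus a b (x\<^sub>c, y\<^sub>c)
    = (\<lambda>w. M + stretch (1 / (2 * a)) (1 / (2 * b)) w) ` ((\<lambda>l. l * K) ` sphere 0 1)"
    unfolding m orthocenter_locus_eq image_image M_def
    by (intro image_cong) (simp_all add: stretch_def algebra_simps)
  also have "\<dots> = range (\<lambda>t. M + (p * cos t) *\<^sub>R (0, 1) + (s * sin t) *\<^sub>R (1, 0))"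
    unfolding image_mult_sphere image_image by (simp add: stretch_def p_def s_def add.assoc)
  also have "\<dots> = {M + (p * cos t) *\<^sub>R (0, 1) + (s * sin t) *\<^sub>R (1, 0) | t. True}"
    by auto
  finally have "orthocenter_locus a b (x\<^sub>c, y\<^sub>c)
    = {M + (p * cos t) *\<^sub>R (0, 1) + (s * sin t) *\<^sub>R (1, 0) | t. True}" .
  moreover have "0 \<le> s" "s \<le> p"
    using a b_pos b_less_a unfolding s_def p_def by (auto intro!: divide_left_mono)
  ultimately have "ellipse_with_semiaxes (orthocenter_locus a b (x\<^sub>c, y\<^sub>c)) p s"
    unfolding ellipse_with_semiaxes_def
    by (intro conjI exI[of _ M] exI[of _ "(0, 1)"] exI[of _ "(1, 0)"]) (auto simp: norm_Pair)
  then show ?thesis using axes by blast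
qed

end
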